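(* Let $s\ge 1$ and $q$ be integers with $0\le q\le s$, and let $n=T_s+q$. For every $(a,b)\in\Pi_n$, the canonical representative $\lambda^{\mathrm{can}}_{s,q}(a,b)$ belongs to the fibre $M_n^{(a,b)}$. In particular, every fibre $M_n^{(a,b)}$ with $(a,b)\in\Pi_n$ is nonempty.
   Context: For an integer $m\ge 0$, $T_m:=m(m+1)/2$. Compressed form: a partition $\lambda$ is written $\lambda=(L_1^{m_1},\dots,L_r^{m_r})$ with $L_1>\cdots>L_r>0$ its distinct part sizes and $m_i\ge 1$ the multiplicity of $L_i$; its support size is $r$. Gaps: $g_i=L_i-L_{i+1}$ for $1\le i<r$ and $g_r=L_r$ (so $L_i=\sum_{j=i}^r g_j$; positive integers $g_1,\dots,g_r,m_1,\dots,m_r$ determine a unique partition of support size $r$). Set $A(\lambda):=\#\{i:g_i>1\}$ and $B(\lambda):=\#\{i:m_i>1\}$. Partition graph: for $n\ge 1$, $G_n$ is the simple graph whose vertices are the integer partitions of $n$; two distinct partitions are adjacent if one is obtained from the other by an elementary transfer of one unit from one part to another (subtract $1$ from one part and add $1$ to another part), followed by reordering. Here the receiving part may be a zero part (so a new part $1$ may be created), and parts that become $0$ are discarded. $\deg(\lambda)$ is the degree of $\lambda$ in $G_n$, $\Delta_n:=\max_{\lambda\vdash n}\deg(\lambda)$, $M_n:=\{\lambda\vdash n:\deg(\lambda)=\Delta_n\}$, $\Pi_n:=\{(A(\lambda),B(\lambda)):\lambda\in M_n\}$, and $M_n^{(a,b)}:=\{\lambda\in M_n:(A(\lambda),B(\lambda))=(a,b)\}$.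 Canonical representative: for $n=T_s+q$, $0\le q\le s$, and $(a,b)\in\Pi_n$, put $\ell:=q-T_a-T_b$ (which is $\ge 0$). Then $\lambda^{\mathrm{can}}_{s,q}(a,b)$ is the partition of support size $s$ with compressed data: $g_1=2+\ell$ if $a>0$ and $g_1=1$ if $a=0$; $g_2=\cdots=g_a=2$; $g_{a+1}=\cdots=g_s=1$; $m_1=\cdots=m_{s-b}=1$ and $m_{s-b+1}=\cdots=m_s=2$ (all multiplicities equal to $1$ if $b=0$). *)

theory Defs
  imports Main "HOL-Library.Multiset" "HOL-Library.Nat_Bijection"
begin

text \<open>
  A partition is the multiset of its (positive) parts.  The triangular number $T_m$ is the
  library constant \<^const>\<open>triangle\<close>.
\<close>

definition partitions :: "nat \<Rightarrow> nat multiset set" where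
  "partitions n = {lam. 0 \<notin># lam \<and> sum_mset lam = n}"


subsection \<open>Compressed form\<close>

definition support_size :: "nat multiset \<Rightarrow> nat" where
  "support_size lam = card (set_mset lam)"

text \<open>Indices in compressed data run from 1 to the support size, largest part size first.\<close>

definition part_size :: "nat multiset \<Rightarrow> nat \<Rightarrow> nat" where
  "part_size lam i = rev (sorted_list_of_set (set_mset lam)) ! (i - 1)"

definition part_mult :: "nat multiset \<Rightarrow> nat \<Rightarrow> nat" where
  "part_mult lam i = count lam (part_size lam i)"

definition gap :: "nat multiset \<Rightarrow> nat \<Rightarrow> nat" where
  "gap lam i = (if i < support_size lam then part_size lam i - part_size lam (i + 1)
                else part_size lam i)"

definition A_num :: "nat multiset \<Rightarrow> nat" where
  "A_num lam = card {i \<in> {1..support_size lam}. gap lam i > 1}"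

definition B_num :: "nat multiset \<Rightarrow> nat" where
  "B_num lam = card {i \<in> {1..support_size lam}. part_mult lam i > 1}"

text \<open>The partition of support size \<open>r\<close> with gaps \<open>g\<close> and multiplicities \<open>m\<close>
  (all positive on \<open>1..r\<close>).\<close>

definition of_compressed :: "nat \<Rightarrow> (nat \<Rightarrow> nat) \<Rightarrow> (nat \<Rightarrow> nat) \<Rightarrow> nat multiset" where
  "of_compressed r g m = (\<Sum>i = 1..r. replicate_mset (m i) (\<Sum>j = i..r. g j))"


subsection \<open>The partition graph\<close>

text \<open>
  One zero part is added to \<open>lam\<close>, so that the receiving part \<open>y\<close> may be zero.  Since \<open>x\<close> and \<open>y\<close>
  are taken out of the multiset together, they are two different parts, possibly of equal size.
\<close>

definition transfer_step :: "nat multiset \<Rightarrow> nat multiset \<Rightarrow> bool" where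
  "transfer_step lam mu \<longleftrightarrow>
     (\<exists>x y rest. add_mset 0 lam = {#x, y#} + rest \<and> x > 0 \<and>
        mu = filter_mset (\<lambda>k. k > 0) ({#x - 1, y + 1#} + rest))"

definition adjacent :: "nat multiset \<Rightarrow> nat multiset \<Rightarrow> bool" where
  "adjacent lam mu \<longleftrightarrow> lam \<noteq> mu \<and> (transfer_step lam mu \<or> transfer_step mu lam)"

definition deg :: "nat \<Rightarrow> nat multiset \<Rightarrow> nat" where
  "deg n lam = card {mu \<in> partitions n. adjacent lam mu}"

definition max_deg :: "nat \<Rightarrow> nat" where
  "max_deg n = Max (deg n ` partitions n)"

definition max_partitions :: "nat \<Rightarrow> nat multiset set" where
  "max_partitions n = {lam \<in> partitions n. deg n lam = max_deg n}"

definition max_types :: "nat \<Rightarrow> (nat \<times> nat) set" where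
  "max_types n = (\<lambda>lam. (A_num lam, B_num lam)) ` max_partitions n"

definition fibre :: "nat \<Rightarrow> nat \<Rightarrow> nat \<Rightarrow> nat multiset set" where
  "fibre n a b = {lam \<in> max_partitions n. (A_num lam, B_num lam) = (a, b)}"


subsection \<open>The canonical representative\<close>

text \<open>
  The surplus \<open>l = q - triangle a - triangle b\<close> is nonnegative for all \<open>(a, b)\<close> of interest.
  Truncated subtraction cannot turn a false claim into a true one: if
  \<open>triangle a + triangle b > q\<close>, then \<open>canonical s q a b\<close> is not in \<open>fibre (triangle s + q) a b\<close>,
  because its type is not \<open>(a, b)\<close> (if \<open>a > s\<close> or \<open>b > s\<close>) or its size is too large.
\<close>

definition canonical :: "nat \<Rightarrow> nat \<Rightarrow> nat \<Rightarrow> nat \<Rightarrow> nat multiset" where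
  "canonical s q a b =
     (let l = q - triangle a - triangle b in
      of_compressed s
        (\<lambda>i. if i = 1 then (if a > 0 then 2 + l else 1) else if i \<le> a then 2 else 1)
        (\<lambda>i. if i \<le> s - b then 1 else 2))"

end

theory Submission
  imports Defs
begin

text \<open>
  A transfer from a part of size \<open>x\<close> to a part of size \<open>y\<close> changes the conjugate partition only in
  the positions \<open>x\<close> (minus one) and \<open>y + 1\<close> (plus one), so nontrivial transfers with different
  \<open>(x, y)\<close> lead to different partitions.  Counting the pairs gives degree \<open>r (r - 1) + A + B\<close>
  for support size \<open>r\<close>.  A partition of \<open>n\<close> with these parameters satisfies
  \<open>n \<ge> T\<^sub>r + T\<^sub>A + T\<^sub>B\<close>.  Comparing with the canonical representatives
  of type \<open>(0, 0)\<close> or \<open>(1, 0)\<close>, a maximiser has support size \<open>s\<close>, hence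
  \<open>T\<^sub>a + T\<^sub>b \<le> q\<close>, and the canonical representative of type \<open>(a, b)\<close> exists and
  has the same degree.
\<close>

section \<open>Compressed data as sets of part sizes\<close>

text \<open>Index-free form of a gap exceeding 1: the predecessor of the part size is missing. The
  inserted 0 acts as the size following the smallest part, so the last gap is no special case; a
  plain set also allows induction on its maximum.\<close>

definition gap_set :: "nat set \<Rightarrow> nat set" where
  "gap_set S = {x \<in> S. x - 1 \<notin> insert 0 S}"

definition repeated :: "nat multiset \<Rightarrow> nat set" where
  "repeated lam = {x \<in> set_mset lam. count lam x > 1}"

lemma finite_gap_set: "finite S \<Longrightarrow> finite (gap_set S)"
  by (simp add: gap_set_def)

lemma gap_set_subset: "gap_set S \<subseteq> S"
  by (auto simp: gap_set_def)

lemma card_gap_set_le: "finite S \<Longrightarrow> card (gap_set S) \<le> card S"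
  by (simp add: card_mono gap_set_subset)

lemma card_repeated_le: "card (repeated lam) \<le> support_size lam"
  unfolding support_size_def by (rule card_mono) (auto simp: repeated_def)

lemma part_size_less:
  assumes "1 \<le> i" "i < j" "j \<le> support_size lam"
  shows "part_size lam j < part_size lam i"
proof -
  have sorted: "sorted_wrt (>) (rev (sorted_list_of_set (set_mset lam)))"
    by (simp add: sorted_wrt_rev)
  show ?thesis
    using assms sorted_wrt_nth_less[OF sorted, of "i - 1" "j - 1"]
    by (simp add: part_size_def support_size_def)
qed

lemma part_size_image: "part_size lam ` {1..support_size lam} = set_mset lam"
proof -
  let ?xs = "rev (sorted_list_of_set (set_mset lam))"
  have "part_size lam ` {1..support_size lam} = (!) ?xs ` (\<lambda>i. i - 1) ` {1..length ?xs}"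
    by (simp add: part_size_def support_size_def image_image)
  also have "(\<lambda>i. i - 1) ` {1..length ?xs} = {0..<length ?xs}"
  proof -
    have "k \<in> (\<lambda>i. i - 1) ` {1..length ?xs}" if "k < length ?xs" for k
      using that by (intro image_eqI[of _ _ "Suc k"]) auto
    then show ?thesis by fastforce
  qed
  also have "(!) ?xs ` {0..<length ?xs} = set ?xs"
    by (metis list.set_map map_nth set_upt)
  finally show ?thesis by simp
qed

lemma inj_on_part_size: "inj_on (part_size lam) {1..support_size lam}"
  by (rule linorder_inj_onI) (use part_size_less in fastforce)+

text \<open>Sizes strictly decrease with the index, so \<open>part_size lam i - 1\<close> can be a
  size only if it is the next one. At the last index, 0 takes the role of the next size.\<close>

lemma one_less_gap_iff:
  assumes "0 \<notin># lam" "1 \<le> i" "i \<le> support_size lam"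
  shows "gap lam i > 1 \<longleftrightarrow> part_size lam i - 1 \<notin> insert 0 (set_mset lam)"
proof (cases "i < support_size lam")
  case True
  let ?p = "part_size lam"
  have mem: "?p (Suc i) \<in># lam"
    using True part_size_image[of lam] by auto
  have lt: "?p (Suc i) < ?p i"
    using True assms by (intro part_size_less) auto
  have "?p i - 1 \<notin># lam" if "?p i - ?p (Suc i) > 1"
  proof
    assume "?p i - 1 \<in># lam"
    then obtain k where k: "1 \<le> k" "k \<le> support_size lam" "?p k = ?p i - 1"
      using part_size_image[of lam] by force
    consider "k \<le> i" | "k = Suc i" | "Suc i < k" by linarith
    then show False
    proof cases
      case 1
      then have "?p i \<le> ?p k"
        using part_size_less[of k i lam] k assms by (cases "k = i") auto
      then show False using k that by linarith
    next
      case 2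
      then show False using k that by simp
    next
      case 3
      then have "?p k < ?p (Suc i)"
        using part_size_less[of "Suc i" k lam] k by auto
      then show False using k that by linarith
    qed
  qed
  moreover have "?p i - 1 = ?p (Suc i)" if "\<not> ?p i - ?p (Suc i) > 1"
    using that lt by linarith
  moreover have "?p i - 1 \<noteq> 0" if "?p i - ?p (Suc i) > 1"
    using that by linarith
  ultimately show ?thesis
    using True mem unfolding gap_def by (metis Suc_eq_plus1 insert_iff)
next
  case False
  let ?p = "part_size lam"
  have i: "i = support_size lam" using False assms by simp
  have "?p i \<in># lam" using assms part_size_image[of lam] by auto
  then have pos: "?p i > 0" using assms(1) by (metis gr0I)
  have "?p i - 1 \<notin># lam"
  proof
    assume "?p i - 1 \<in># lam"
    then obtain k where k: "1 \<le> k" "k \<le> support_size lam" "?p k = ?p i - 1"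
      using part_size_image[of lam] by force
    have "?p i \<le> ?p k"
      using part_size_less[of k i lam] k i by (cases "k = i") auto
    then show False using k pos by linarith
  qed
  then show ?thesis
    using i pos by (auto simp: gap_def)
qed

lemma A_num_eq:
  assumes "0 \<notin># lam"
  shows "A_num lam = card (gap_set (set_mset lam))"
proof -
  let ?I = "{i \<in> {1..support_size lam}. gap lam i > 1}"
  have "part_size lam ` ?I = gap_set (set_mset lam)"
  proof -
    have "?I = {i \<in> {1..support_size lam}. part_size lam i - 1 \<notin> insert 0 (set_mset lam)}"
      using one_less_gap_iff[OF assms] by (meson atLeastAtMost_iff)
    then have "part_size lam ` ?I
        = {x \<in> part_size lam ` {1..support_size lam}. x - 1 \<notin> insert 0 (set_mset lam)}"
      by auto
    then show ?thesis by (simp add: part_size_image gap_set_def del: One_nat_def)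
  qed
  moreover have "inj_on (part_size lam) ?I"
    by (rule inj_on_subset[OF inj_on_part_size]) auto
  ultimately show ?thesis
    unfolding A_num_def by (metis card_image)
qed

lemma B_num_eq: "B_num lam = card (repeated lam)"
proof -
  let ?I = "{i \<in> {1..support_size lam}. part_mult lam i > 1}"
  have "part_size lam ` ?I
      = {x \<in> part_size lam ` {1..support_size lam}. count lam x > 1}"
    by (auto simp: part_mult_def)
  then have "part_size lam ` ?I = repeated lam"
    by (simp add: part_size_image repeated_def del: One_nat_def)
  moreover have "inj_on (part_size lam) ?I"
    by (rule inj_on_subset[OF inj_on_part_size]) auto
  ultimately show ?thesis
    unfolding B_num_def by (metis card_image)
qed


section \<open>The degree formula\<close>

text \<open>Moves are recorded by sizes, since equal parts give equal results. The condition
  \<open>x \<noteq> y + 1\<close> excludes moves that merely exchange the two sizes; a move between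
  equal sizes needs two copies.\<close>

definition transfers :: "nat multiset \<Rightarrow> (nat \<times> nat) set" where
  "transfers lam = {(x, y). x \<in># lam \<and> y \<in> insert 0 (set_mset lam) \<and>
     x \<noteq> y + 1 \<and> (x = y \<longrightarrow> count lam x > 1)}"

definition transfer :: "nat multiset \<Rightarrow> nat \<times> nat \<Rightarrow> nat multiset" where
  "transfer lam = (\<lambda>(x, y).
     filter_mset (\<lambda>k. k > 0) ({#x - 1, y + 1#} + (add_mset 0 lam - {#x, y#})))"

text \<open>Only the counts at \<open>x\<close> and \<open>y\<close> matter. The adjoined zero
  occurs exactly once and cannot be \<open>x\<close>, so it only adds a possible receiver.\<close>

lemma pair_subseteq_iff:
  fixes x y :: nat
  assumes "0 \<notin># lam" "x > 0"
  shows "{#x, y#} \<subseteq># add_mset 0 lam \<longleftrightarrow>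
    x \<in># lam \<and> y \<in> insert 0 (set_mset lam) \<and> (x = y \<longrightarrow> count lam x > 1)"
proof -
  obtain k where "x = Suc k" using assms(2) gr0_implies_Suc by blast
  have "{#x, y#} \<subseteq># add_mset 0 lam \<longleftrightarrow> (\<forall>k. count {#x, y#} k \<le> count (add_mset 0 lam) k)"
    by (simp add: subseteq_mset_def)
  also have "\<dots> \<longleftrightarrow> count {#x, y#} x \<le> count (add_mset 0 lam) x \<and>
      count {#x, y#} y \<le> count (add_mset 0 lam) y"
    by auto
  also have "\<dots> \<longleftrightarrow> x \<in># lam \<and> y \<in> insert 0 (set_mset lam) \<and> (x = y \<longrightarrow> count lam x > 1)"
    using assms(1) \<open>x = Suc k\<close> by - (cases "x = y"; cases "y = 0";
      auto simp: count_greater_zero_iff[symmetric] Suc_le_eq simp del: count_greater_zero_iff)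
  finally show ?thesis .
qed

lemma transfer_step_iff:
  "transfer_step lam mu \<longleftrightarrow>
    (\<exists>x y. x > 0 \<and> {#x, y#} \<subseteq># add_mset 0 lam \<and> mu = transfer lam (x, y))"
proof
  assume "transfer_step lam mu"
  then obtain x y rest where h: "add_mset 0 lam = {#x, y#} + rest" "x > 0"
      "mu = filter_mset (\<lambda>k. k > 0) ({#x - 1, y + 1#} + rest)"
    unfolding transfer_step_def by blast
  have "{#x, y#} \<subseteq># add_mset 0 lam" "rest = add_mset 0 lam - {#x, y#}"
    unfolding h(1) by (rule mset_subset_eq_add_left, rule add_diff_cancel_left'[symmetric])
  with h(2,3) show "\<exists>x y. x > 0 \<and> {#x, y#} \<subseteq># add_mset 0 lam \<and> mu = transfer lam (x, y)"
    unfolding transfer_def prod.case by blast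
next
  assume "\<exists>x y. x > 0 \<and> {#x, y#} \<subseteq># add_mset 0 lam \<and> mu = transfer lam (x, y)"
  then obtain x y where h: "x > 0" "{#x, y#} \<subseteq># add_mset 0 lam" "mu = transfer lam (x, y)"
    by blast
  show "transfer_step lam mu"
    unfolding transfer_step_def using h(1) h(3)[unfolded transfer_def prod.case]
      subset_mset.add_diff_inverse[OF h(2), symmetric] by blast
qed

text \<open>The reverse move takes the unit from \<open>y + 1\<close> back to
  \<open>x - 1\<close>.\<close>

lemma transfer_step_sym:
  assumes "0 \<notin># lam" "transfer_step lam mu"
  shows "transfer_step mu lam"
proof -
  obtain x y rest where h: "add_mset 0 lam = {#x, y#} + rest" "x > 0"
      "mu = filter_mset (\<lambda>k. k > 0) ({#x - 1, y + 1#} + rest)"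
    using assms(2) unfolding transfer_step_def by blast
  let ?rest = "filter_mset (\<lambda>k. k > 0) rest"
  have "lam = filter_mset (\<lambda>k. k > 0) (add_mset 0 lam)"
    using assms(1) by (auto simp: filter_mset_eq_conv) (metis filter_mset_True filter_mset_cong gr0I)
  then have lam: "lam = filter_mset (\<lambda>k. k > 0) ({#y, x#} + rest)"
    using h(1) by (simp add: add_mset_commute)
  show ?thesis
  \<comment> \<open>If \<open>x = 1\<close>, the donor has been discarded and the adjoined zero of
    \<open>mu\<close> is the receiver. Otherwise the receiver is \<open>x - 1\<close> and the
    adjoined zero belongs to the rest.\<close>
  proof (cases "x = 1")
    case True
    then show ?thesis
      unfolding transfer_step_def using lam h
      by (intro exI[of _ "y + 1"] exI[of _ 0] exI[of _ ?rest]) (auto simp: filter_filter_mset)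
  next
    case False
    then show ?thesis
      unfolding transfer_step_def using lam h
      by (intro exI[of _ "y + 1"] exI[of _ "x - 1"] exI[of _ "add_mset 0 ?rest"])
        (auto simp: filter_filter_mset)
  qed
qed

lemma sum_mset_filter_pos: "sum_mset (filter_mset (\<lambda>k. k > 0) M) = sum_mset (M :: nat multiset)"
  by (induction M) auto

lemma transfer_step_partition:
  assumes "transfer_step lam mu"
  shows "mu \<in> partitions (sum_mset lam)"
proof -
  obtain x y rest where h: "add_mset 0 lam = {#x, y#} + rest" "x > 0"
      "mu = filter_mset (\<lambda>k. k > 0) ({#x - 1, y + 1#} + rest)"
    using assms unfolding transfer_step_def by blast
  have "sum_mset lam = sum_mset ({#x, y#} + rest)"
    using h(1) by (metis add_0 sum_mset.add_mset)
  also have "\<dots> = sum_mset mu"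
    using h(2) unfolding h(3) sum_mset_filter_pos by simp
  finally show ?thesis
    by (simp add: partitions_def h(3))
qed

text \<open>The number of parts of size at least \<open>j\<close> is the \<open>j\<close>-th part of
  the conjugate partition. Corrections are added on both sides to avoid truncated subtraction;
  \<open>j > 0\<close> makes discarded zeros invisible.\<close>

lemma size_filter_ge_transfer:
  assumes "{#x, y#} \<subseteq># add_mset 0 lam" "x > 0" "j > 0"
  shows "size (filter_mset (\<lambda>k. k \<ge> j) (transfer lam (x, y))) + (if j = x then 1 else 0)
    = size (filter_mset (\<lambda>k. k \<ge> j) lam) + (if j = y + 1 then 1 else 0)"
proof -
  define rest where "rest = add_mset 0 lam - {#x, y#}"
  have lam: "add_mset 0 lam = {#x, y#} + rest"
    unfolding rest_def using assms(1) by (rule subset_mset.add_diff_inverse[symmetric])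
  have "filter_mset (\<lambda>k. k \<ge> j) (transfer lam (x, y))
      = filter_mset (\<lambda>k. k \<ge> j) ({#x - 1, y + 1#} + rest)"
    unfolding transfer_def prod.case rest_def[symmetric] filter_filter_mset using assms(3)
    by (intro filter_mset_cong) auto
  moreover have "filter_mset (\<lambda>k. k \<ge> j) lam = filter_mset (\<lambda>k. k \<ge> j) ({#x, y#} + rest)"
    unfolding lam[symmetric] using assms(3) by simp
  ultimately show ?thesis
    using assms(2) by auto
qed

lemma transfersD:
  assumes "0 \<notin># lam" "(x, y) \<in> transfers lam"
  shows "x > 0" "{#x, y#} \<subseteq># add_mset 0 lam" "x \<noteq> y + 1"
proof -
  show "x > 0" using assms by (auto simp: transfers_def intro!: gr0I)
  with pair_subseteq_iff[OF assms(1) this] show "{#x, y#} \<subseteq># add_mset 0 lam"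
    using assms(2) by (simp add: transfers_def)
  show "x \<noteq> y + 1" using assms(2) by (simp add: transfers_def)
qed

lemma transfer_neq:
  assumes "0 \<notin># lam" "p \<in> transfers lam"
  shows "transfer lam p \<noteq> lam"
proof -
  obtain x y where p: "p = (x, y)" by (cases p)
  note d = transfersD[OF assms(1) assms(2)[unfolded p]]
  show ?thesis
    using size_filter_ge_transfer[OF d(2,1) d(1)] d(3) p by auto
qed

text \<open>The conjugate partition falls only at position \<open>x\<close> and rises only at
  \<open>y + 1\<close>; as these differ, nothing cancels and both can be read off from the
  result.\<close>

lemma inj_on_transfer:
  assumes "0 \<notin># lam"
  shows "inj_on (transfer lam) (transfers lam)"
proof (rule inj_onI)
  fix p p' assume P: "p \<in> transfers lam" "p' \<in> transfers lam" "transfer lam p = transfer lam p'"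
  obtain x y x' y' where p: "p = (x, y)" "p' = (x', y')" by (cases p, cases p')
  note d = transfersD[OF assms P(1)[unfolded p]]
  note d' = transfersD[OF assms P(2)[unfolded p]]
  note e = P(3)[unfolded p]
  have "x = x'"
    using size_filter_ge_transfer[OF d(2,1) d(1)] size_filter_ge_transfer[OF d'(2,1) d(1)]
      d(3) e by (auto split: if_splits)
  moreover have "y = y'"
    using size_filter_ge_transfer[OF d(2,1), of "y + 1"]
      size_filter_ge_transfer[OF d'(2,1), of "y + 1"] d(3) e
    by (auto split: if_splits)
  ultimately show "p = p'" by (simp add: p)
qed

lemma transfer_trivial:
  assumes "0 \<notin># lam" "{#x, y#} \<subseteq># add_mset 0 lam" "x = y + 1"
  shows "transfer lam (x, y) = lam"
proof -
  have "{#x - 1, y + 1#} + (add_mset 0 lam - {#x, y#}) = add_mset 0 lam"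
    using assms(2,3) by (metis add_diff_cancel_right' add_mset_commute subset_mset.add_diff_inverse)
  moreover have "filter_mset (\<lambda>k. k > 0) (add_mset 0 lam) = lam"
    using assms(1) by (auto simp: filter_mset_eq_conv) (metis filter_mset_True filter_mset_cong gr0I)
  ultimately show ?thesis unfolding transfer_def prod.case by simp
qed

text \<open>Moves are reversible and preserve the sum, so the two directions in
  \<open>adjacent\<close> collapse to one and only the moves that return \<open>lam\<close> must be
  removed.\<close>

lemma neighbours_eq:
  assumes "lam \<in> partitions n"
  shows "{mu \<in> partitions n. adjacent lam mu} = transfer lam ` transfers lam"
proof -
  have z: "0 \<notin># lam" and n: "sum_mset lam = n" using assms by (auto simp: partitions_def)
  have "mu \<in> partitions n \<and> adjacent lam mu \<longleftrightarrow> lam \<noteq> mu \<and> transfer_step lam mu" for mu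
    unfolding adjacent_def
    using transfer_step_sym transfer_step_partition z n by (auto simp: partitions_def)
  moreover have "lam \<noteq> mu \<and> transfer_step lam mu \<longleftrightarrow> mu \<in> transfer lam ` transfers lam" for mu
  proof
    assume L: "lam \<noteq> mu \<and> transfer_step lam mu"
    then obtain x y where h: "x > 0" "{#x, y#} \<subseteq># add_mset 0 lam" "mu = transfer lam (x, y)"
      using transfer_step_iff by blast
    have "x \<noteq> y + 1" using transfer_trivial[OF z h(2)] L h(3) by auto
    with h have "(x, y) \<in> transfers lam"
      using pair_subseteq_iff[OF z h(1)] by (simp add: transfers_def)
    with h(3) show "mu \<in> transfer lam ` transfers lam" by blast
  next
    assume "mu \<in> transfer lam ` transfers lam"
    then obtain x y where h: "(x, y) \<in> transfers lam" "mu = transfer lam (x, y)" by auto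
    then show "lam \<noteq> mu \<and> transfer_step lam mu"
      using transfersD[OF z h(1)] transfer_neq[OF z h(1)] transfer_step_iff by metis
  qed
  ultimately show ?thesis by blast
qed

text \<open>With \<open>r = card S\<close> there are \<open>r * (r + 1)\<close> pairs of a donor and
  a receiver size. Discarded are the pairs \<open>(x, x - 1)\<close> for \<open>x\<close> outside
  \<open>gap_set S\<close> and the pairs \<open>(x, x)\<close> for sizes occurring once; these two
  families are disjoint.\<close>

lemma card_transfers:
  assumes "0 \<notin># lam"
  defines "S \<equiv> set_mset lam"
  shows "card (transfers lam) + card S = card S * card S + card (gap_set S) + card (repeated lam)"
proof -
  let ?step = "(\<lambda>x. (x, x - 1)) ` (S - gap_set S)"
  let ?diag = "(\<lambda>x. (x, x)) ` (S - repeated lam)"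
  have fin: "finite S" by (simp add: S_def)
  have eq: "S \<times> insert 0 S = transfers lam \<union> (?step \<union> ?diag)"
  proof (intro equalityI subsetI)
    fix p assume "p \<in> S \<times> insert 0 S"
    then show "p \<in> transfers lam \<union> (?step \<union> ?diag)"
      by (cases p) (auto simp: transfers_def S_def gap_set_def repeated_def image_iff)
  next
    fix p assume "p \<in> transfers lam \<union> (?step \<union> ?diag)"
    then show "p \<in> S \<times> insert 0 S"
      by (auto simp: transfers_def S_def gap_set_def repeated_def)
  qed
  have pos: "x > 0" if "x \<in> S" for x using that assms(1) by (auto simp: S_def intro!: gr0I)
  have disj: "transfers lam \<inter> (?step \<union> ?diag) = {}"
    using pos by (fastforce simp: transfers_def S_def gap_set_def repeated_def)
  have disj': "?step \<inter> ?diag = {}"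
    using pos by force
  have "finite (transfers lam)"
    by (rule finite_subset[of _ "S \<times> insert 0 S"]) (use fin in \<open>auto simp: transfers_def S_def\<close>)
  then have "card (S \<times> insert 0 S) = card (transfers lam) + card (?step \<union> ?diag)"
    unfolding eq by (rule card_Un_disjoint[OF _ _ disj]) (simp add: fin)
  moreover have "card (?step \<union> ?diag) = card ?step + card ?diag"
    by (rule card_Un_disjoint[OF _ _ disj']) (simp_all add: fin)
  moreover have "card ?step = card S - card (gap_set S)"
    using fin by (subst card_image) (auto simp: inj_on_def finite_gap_set gap_set_def intro!: card_Diff_subset)
  moreover have "card ?diag = card S - card (repeated lam)"
    using fin by (subst card_image) (auto simp: inj_on_def S_def repeated_def intro!: card_Diff_subset)
  moreover have "card (S \<times> insert 0 S) = card S * card S + card S"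
    using fin assms(1) by (simp add: S_def card_cartesian_product)
  moreover have "card (repeated lam) \<le> card S"
    using card_repeated_le[of lam] by (simp add: S_def support_size_def)
  ultimately show ?thesis
    using card_gap_set_le[OF fin] by linarith
qed

theorem deg_eq:
  assumes "lam \<in> partitions n"
  shows "deg n lam + support_size lam = support_size lam * support_size lam + A_num lam + B_num lam"
proof -
  have z: "0 \<notin># lam" using assms by (simp add: partitions_def)
  have "deg n lam = card (transfers lam)"
    unfolding deg_def neighbours_eq[OF assms] by (rule card_image[OF inj_on_transfer[OF z]])
  then show ?thesis
    using card_transfers[OF z] by (simp add: support_size_def A_num_eq[OF z] B_num_eq)
qed


section \<open>The size bound\<close>

lemma triangle_mono: "m \<le> n \<Longrightarrow> triangle m \<le> triangle n"
  by (induction n rule: dec_induct) auto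

lemma le_triangle: "n \<le> triangle n"
  by (induction n) auto

text \<open>The predecessors of the elements of \<open>gap_set S\<close> are distinct, positive and
  outside \<open>S\<close>, so together with \<open>S\<close> they fit into
  \<open>{1..x}\<close>.\<close>

lemma card_add_gap_set_le:
  assumes "finite S" "0 \<notin> S" "\<And>y. y \<in> S \<Longrightarrow> y \<le> x"
  shows "card S + card (gap_set S) \<le> x"
proof -
  let ?G = "(\<lambda>y. y - 1) ` gap_set S"
  have "inj_on (\<lambda>y. y - 1) (gap_set S)"
    by (rule inj_onI) (auto simp: gap_set_def)
  then have "card S + card (gap_set S) = card S + card ?G"
    by (simp add: card_image)
  also have "\<dots> = card (S \<union> ?G)"
    using assms(1) by (subst card_Un_disjoint) (auto simp: gap_set_def)
  also have "\<dots> \<le> card {1..x}"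
  proof (rule card_mono)
    show "S \<union> ?G \<subseteq> {1..x}"
      using assms(2,3) by (fastforce simp: gap_set_def Suc_le_eq intro!: gr0I)
  qed simp
  finally show ?thesis by simp
qed

text \<open>Adding a new maximum \<open>x\<close> raises the first triangular number by the new
  cardinality and the second by at most the new number of gaps; by the preceding lemma
  \<open>x\<close> covers both.\<close>

lemma sum_set_ge:
  assumes "finite S" "0 \<notin> S"
  shows "triangle (card S) + triangle (card (gap_set S)) \<le> \<Sum>S"
  using assms
proof (induction S rule: finite_linorder_max_induct)
  case empty
  then show ?case by (simp add: gap_set_def)
next
  case (insert x S)
  let ?S = "insert x S"
  have "x \<notin> S" using insert by auto
  then have card: "card ?S = Suc (card S)" using insert by simp
  have le: "card ?S + card (gap_set ?S) \<le> x"
    using insert by (intro card_add_gap_set_le) auto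
  have "gap_set ?S \<subseteq> insert x (gap_set S)"
    by (auto simp: gap_set_def)
  then have "card (gap_set ?S) \<le> card (insert x (gap_set S))"
    using insert(1) by (intro card_mono) (auto simp: finite_gap_set)
  also have "\<dots> \<le> Suc (card (gap_set S))"
    by (rule card_insert_le_m1) auto
  finally have up: "card (gap_set ?S) \<le> Suc (card (gap_set S))" .
  \<comment> \<open>If the number of gaps grows, this is the recursion of \<open>triangle\<close>;
    otherwise monotonicity suffices.\<close>
  have "triangle (card (gap_set ?S)) \<le> triangle (card (gap_set S)) + card (gap_set ?S)"
  proof (cases "card (gap_set ?S) = Suc (card (gap_set S))")
    case False
    with up have "card (gap_set ?S) \<le> card (gap_set S)" by simp
    from triangle_mono[OF this] show ?thesis by simp
  qed simp
  with insert le card \<open>x \<notin> S\<close> show ?case by simp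
qed

lemma triangle_card_le_sum:
  assumes "finite S" "0 \<notin> S"
  shows "triangle (card S) \<le> \<Sum>S"
  using sum_set_ge[OF assms] by simp

lemma sum_mset_eq_sum_count: "sum_mset lam = (\<Sum>x\<in>set_mset lam. count lam x * x)"
  for lam :: "nat multiset"
proof (induction lam)
  case (add a lam)
  have "(\<Sum>x\<in>set_mset (add_mset a lam). count (add_mset a lam) x * x)
      = (\<Sum>x\<in>insert a (set_mset lam). count lam x * x + (if x = a then a else 0))"
    by (auto intro!: sum.cong)
  also have "\<dots> = (\<Sum>x\<in>insert a (set_mset lam). count lam x * x) + a"
    by (simp add: sum.distrib)
  also have "(\<Sum>x\<in>insert a (set_mset lam). count lam x * x) = (\<Sum>x\<in>set_mset lam. count lam x * x)"
    by (rule sum.mono_neutral_right) (auto simp: not_in_iff)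
  finally show ?case using add by simp
qed simp

text \<open>One copy of each size contributes at least \<open>triangle r + triangle A\<close>, where
  \<open>r\<close>, \<open>A\<close>, \<open>B\<close> are the support size and the two counts. A
  second copy of each repeated size contributes a sum of \<open>B\<close> distinct positive
  numbers.\<close>

lemma partition_size_ge:
  assumes "lam \<in> partitions n"
  shows "triangle (support_size lam) + triangle (A_num lam) + triangle (B_num lam) \<le> n"
proof -
  have z: "0 \<notin># lam" and n: "sum_mset lam = n" using assms by (auto simp: partitions_def)
  let ?S = "set_mset lam"
  have "(\<Sum>x\<in>?S. x + (if count lam x > 1 then x else 0)) \<le> (\<Sum>x\<in>?S. count lam x * x)"
  proof (rule sum_mono)
    fix x assume "x \<in> ?S"
    then have "count lam x \<ge> 1" by simp
    moreover have "2 * x \<le> count lam x * x" if "count lam x > 1"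
      using that by (intro mult_le_mono1) simp
    ultimately show "x + (if count lam x > 1 then x else 0) \<le> count lam x * x"
      by (simp add: mult_2)
  qed
  moreover have "(\<Sum>x\<in>?S. x + (if count lam x > 1 then x else 0)) = \<Sum>?S + \<Sum>(repeated lam)"
    by (simp add: sum.distrib sum.inter_filter[symmetric] repeated_def)
  moreover have "triangle (card (repeated lam)) \<le> \<Sum>(repeated lam)"
    using z by (intro triangle_card_le_sum) (auto simp: repeated_def)
  moreover have "triangle (card ?S) + triangle (card (gap_set ?S)) \<le> \<Sum>?S"
    using z by (intro sum_set_ge) auto
  ultimately show ?thesis
    using n by (simp add: support_size_def A_num_eq[OF z] B_num_eq sum_mset_eq_sum_count)
qed

text \<open>The general bound, \<open>3 * triangle r\<close> here, would not exclude \<open>r = 1\<close>, \<open>n = 3\<close>.\<close>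

lemma partition_size_ge_full:
  assumes "lam \<in> partitions n" "A_num lam = support_size lam" "B_num lam = support_size lam"
  shows "4 * triangle (support_size lam) \<le> n"
proof -
  have z: "0 \<notin># lam" and n: "sum_mset lam = n" using assms by (auto simp: partitions_def)
  let ?S = "set_mset lam"
  \<comment> \<open>Every size occurs at least twice, so the bound for the set of sizes, here
    \<open>2 * triangle r\<close>, is doubled.\<close>
  have "repeated lam = ?S"
    using assms(3) by (intro card_subset_eq) (auto simp: B_num_eq support_size_def repeated_def)
  moreover have "2 \<le> count lam x" if "x \<in> repeated lam" for x
    using that by (auto simp: repeated_def)
  ultimately have "(\<Sum>x\<in>?S. 2 * x) \<le> (\<Sum>x\<in>?S. count lam x * x)"
    by (intro sum_mono mult_le_mono1) simp
  then have "2 * \<Sum>?S \<le> n"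
    using n by (simp add: sum_mset_eq_sum_count sum_distrib_left)
  moreover have "triangle (card ?S) + triangle (card (gap_set ?S)) \<le> \<Sum>?S"
    using z by (intro sum_set_ge) auto
  ultimately show ?thesis
    using assms(2) by (simp add: A_num_eq[OF z] support_size_def)
qed

section \<open>Existence of the maximum degree\<close>

text \<open>Ensures that \<open>Max\<close> in \<open>max_deg\<close> is a genuine maximum. Positive
  parts with sum \<open>n\<close> number at most \<open>n\<close>, and each is at most
  \<open>n\<close>.\<close>

lemma finite_partitions: "finite (partitions n)"
proof (rule finite_subset)
  show "partitions n \<subseteq> mset ` {xs. set xs \<subseteq> {..n} \<and> length xs \<le> n}"
  proof
    fix lam assume lam: "lam \<in> partitions n"
    obtain xs where xs: "mset xs = lam" by (metis ex_mset)
    have le: "size M \<le> sum_mset M" if "0 \<notin># M" for M :: "nat multiset"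
      using that by (induction M) auto
    have "length xs \<le> n" using lam xs le[of lam] by (auto simp: partitions_def)
    moreover have "k \<le> n" if "k \<in> set xs" for k
      using that lam xs by (metis (mono_tags, lifting) partitions_def mem_Collect_eq set_mset_mset
          sum_mset.remove le_add1)
    ultimately show "lam \<in> mset ` {xs. set xs \<subseteq> {..n} \<and> length xs \<le> n}"
      using xs by auto
  qed
qed (simp add: finite_lists_length_le)

lemma deg_le_max_deg: "lam \<in> partitions n \<Longrightarrow> deg n lam \<le> max_deg n"
  unfolding max_deg_def by (intro Max_ge) (auto simp: finite_partitions)


section \<open>Canonical representatives\<close>

text \<open>Exchange of summation: the gap \<open>g j\<close> is counted once in every part whose
  index is at most \<open>j\<close>.\<close>

lemma sum_mset_of_compressed:
  "sum_mset (of_compressed r g m) = (\<Sum>j = 1..r. g j * (\<Sum>i = 1..j. m i))"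
proof -
  have "sum_mset (of_compressed r g m) = (\<Sum>i = 1..r. m i * (\<Sum>j = i..r. g j))"
    unfolding of_compressed_def
    by (induction rule: infinite_finite_induct) (auto simp: sum_mset_replicate_mset)
  also have "\<dots> = (\<Sum>j = 1..r. g j * (\<Sum>i = 1..j. m i))"
  proof (induction r)
    case (Suc r)
    have "(\<Sum>i = 1..Suc r. m i * (\<Sum>j = i..Suc r. g j))
        = (\<Sum>i = 1..r. m i * (\<Sum>j = i..r. g j) + m i * g (Suc r)) + m (Suc r) * g (Suc r)"
      by (auto simp: algebra_simps intro!: sum.cong)
    then show ?case
      using Suc by (simp add: sum.distrib sum_distrib_right[symmetric] algebra_simps)
  qed simp
  finally show ?thesis .
qed

section \<open>Recovering compressed data from the partition\<close>

context
  fixes r :: nat and g m :: "nat \<Rightarrow> nat"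
  assumes g_pos: "\<And>i. 1 \<le> i \<Longrightarrow> i \<le> r \<Longrightarrow> g i > 0"
    and m_pos: "\<And>i. 1 \<le> i \<Longrightarrow> i \<le> r \<Longrightarrow> m i > 0"
begin

private abbreviation L :: "nat \<Rightarrow> nat" where
  "L i \<equiv> (\<Sum>j = i..r. g j)"

private lemma L_step: "i \<le> r \<Longrightarrow> L i = g i + L (Suc i)"
  by (simp add: sum.atLeast_Suc_atMost)

text \<open>The range reaches \<open>Suc r\<close>, where the empty sum is 0; this gives positivity
  of the sizes and lets 0 act as a further term of the sequence.\<close>

private lemma L_less:
  assumes "1 \<le> i" "i < j" "j \<le> Suc r"
  shows "L j < L i"
proof -
  have "L j \<le> L (Suc i)"
    using assms by (intro sum_mono2) auto
  then show ?thesis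
    using assms L_step[of i] g_pos[of i] by simp
qed

private lemma inj_on_L: "inj_on L {1..r}"
  by (rule linorder_inj_onI) (use L_less in fastforce)+

private lemma L_pos: "1 \<le> i \<Longrightarrow> i \<le> r \<Longrightarrow> L i > 0"
  using L_less[of i "Suc r"] by simp

lemma set_of_compressed: "set_mset (of_compressed r g m) = L ` {1..r}"
  using m_pos by (fastforce simp: of_compressed_def set_mset_sum)

lemma count_of_compressed:
  assumes "i \<in> {1..r}"
  shows "count (of_compressed r g m) (L i) = m i"
proof -
  have "count (of_compressed r g m) (L i) = (\<Sum>k = 1..r. if L i = L k then m k else 0)"
    unfolding of_compressed_def count_sum by (intro sum.cong) auto
  also have "\<dots> = (\<Sum>k = 1..r. if i = k then m k else 0)"
    using inj_on_L assms by (intro sum.cong) (auto dest: inj_onD)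
  finally show ?thesis using assms by simp
qed

lemma zero_notin_of_compressed: "0 \<notin># of_compressed r g m"
  using L_pos by (force simp: set_of_compressed)

lemma support_size_of_compressed: "support_size (of_compressed r g m) = r"
  unfolding support_size_def set_of_compressed by (simp add: card_image[OF inj_on_L[simplified]])

lemma B_num_of_compressed: "B_num (of_compressed r g m) = card {i \<in> {1..r}. m i > 1}"
proof -
  have "repeated (of_compressed r g m) = L ` {i \<in> {1..r}. m i > 1}"
    unfolding repeated_def set_of_compressed using count_of_compressed by auto
  moreover have "inj_on L {i \<in> {1..r}. m i > 1}"
    by (rule inj_on_subset[OF inj_on_L]) auto
  ultimately show ?thesis
    by (simp add: B_num_eq card_image)
qed

lemma A_num_of_compressed: "A_num (of_compressed r g m) = card {i \<in> {1..r}. g i > 1}"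
proof -
  \<comment> \<open>Since \<open>L (Suc r) = 0\<close>, the last gap is also a difference of
    consecutive terms.\<close>
  have zero: "insert 0 (L ` {1..r}) = L ` {1..Suc r}"
    by (simp add: atLeastAtMostSuc_conv)
  have "L i - 1 \<notin> L ` {1..Suc r} \<longleftrightarrow> g i > 1" if i: "1 \<le> i" "i \<le> r" for i
  proof
    assume notin: "L i - 1 \<notin> L ` {1..Suc r}"
    have "g i \<noteq> 1"
    proof
      assume "g i = 1"
      then have "L i - 1 = L (Suc i)" using L_step i by simp
      then show False using notin i by fastforce
    qed
    then show "g i > 1" using g_pos[of i] i by simp
  next
    assume g: "g i > 1"
    show "L i - 1 \<notin> L ` {1..Suc r}"
    proof
      assume "L i - 1 \<in> L ` {1..Suc r}"
      then obtain k where k: "1 \<le> k" "k \<le> Suc r" "L i - 1 = L k" by auto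
      show False
      proof (cases "k \<le> i")
        case True
        then have "L i \<le> L k" using L_less[of k i] k i by (cases "k = i") auto
        then show False using k L_pos[of i] i by linarith
      next
        case False
        then have "L k \<le> L (Suc i)" using L_less[of "Suc i" k] k i by (cases "k = Suc i") auto
        then show False using k L_step[of i] i g by linarith
      qed
    qed
  qed
  then have "gap_set (set_mset (of_compressed r g m)) = L ` {i \<in> {1..r}. g i > 1}"
    unfolding gap_set_def set_of_compressed zero by auto
  moreover have "inj_on L {i \<in> {1..r}. g i > 1}"
    by (rule inj_on_subset[OF inj_on_L]) auto
  ultimately show ?thesis
    by (simp add: A_num_eq[OF zero_notin_of_compressed] card_image)
qed

end

lemma sum_atLeastAtMost_eq_triangle: "(\<Sum>j = 1..n. j) = triangle n"
  by (induction n) auto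

text \<open>Truncated subtraction annihilates the first \<open>c\<close> terms.\<close>

lemma sum_diff_eq_triangle: "(\<Sum>j = 1..n. j - c) = triangle (n - c)"
proof (induction n)
  case (Suc n)
  then show ?case by (cases "c \<le> n") (auto simp: Suc_diff_le)
qed simp

text \<open>The surplus is absorbed by the first gap, which is enlarged only if
  \<open>a > 0\<close>; for \<open>a = 0\<close> it must vanish, hence the hypothesis
  \<open>a0\<close>.\<close>

lemma canonical:
  assumes "1 \<le> s" "q \<le> s" "triangle a + triangle b \<le> q"
    and a0: "a = 0 \<Longrightarrow> triangle b = q"
  defines "lam \<equiv> canonical s q a b"
  shows "lam \<in> partitions (triangle s + q)" "support_size lam = s" "A_num lam = a" "B_num lam = b"
proof -
  define l where "l = q - triangle a - triangle b"
  define g where "g = (\<lambda>i. if i = 1 then (if a > 0 then 2 + l else 1) else if i \<le> a then 2 else (1::nat))"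
  define m where "m = (\<lambda>i. if i \<le> s - b then 1 else (2::nat))"
  have lam: "lam = of_compressed s g m"
    by (simp add: lam_def canonical_def l_def g_def m_def Let_def cong: if_cong)
  have pos: "g i > 0" "m i > 0" for i by (auto simp: g_def m_def)
  \<comment> \<open>This separates the first \<open>a\<close> indices, with enlarged gaps, from the
    last \<open>b\<close> indices, with doubled multiplicities.\<close>
  have ab: "a + b \<le> s"
    using le_triangle[of a] le_triangle[of b] assms by linarith
  show "support_size lam = s"
    unfolding lam by (rule support_size_of_compressed) (use pos in auto)
  have "{i \<in> {1..s}. g i > 1} = {1..a}"
    using ab by (auto simp: g_def split: if_splits)
  moreover have "A_num lam = card {i \<in> {1..s}. g i > 1}"
    unfolding lam by (rule A_num_of_compressed) (use pos in auto)
  ultimately show "A_num lam = a" by simp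
  have "{i \<in> {1..s}. m i > 1} = {s - b<..s}"
    by (auto simp: m_def split: if_splits)
  moreover have "B_num lam = card {i \<in> {1..s}. m i > 1}"
    unfolding lam by (rule B_num_of_compressed) (use pos in auto)
  ultimately show "B_num lam = b" using ab by simp
  have M: "(\<Sum>i = 1..j. m i) = j + (j - (s - b))" for j
    by (induction j) (auto simp: m_def)
  have "sum_mset lam = (\<Sum>j = 1..s. g j * (j + (j - (s - b))))"
    unfolding lam sum_mset_of_compressed M ..
  \<comment> \<open>For \<open>j \<le> a\<close> the term \<open>j - (s - b)\<close> is 0, so
    enlarged gaps contribute only multiples of \<open>j\<close>. The four summands yield
    \<open>triangle s\<close>, \<open>triangle b\<close>, \<open>triangle a\<close> and the
    surplus.\<close>
  also have "\<dots> = (\<Sum>j = 1..s. j + (j - (s - b)) + (if j \<le> a then j else 0)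
      + (if j = 1 then (if a > 0 then l else 0) else 0))"
    using ab by (intro sum.cong) (auto simp: g_def)
  also have "\<dots> = triangle s + triangle (s - (s - b)) + (\<Sum>j = 1..s. if j \<le> a then j else 0)
      + (if a > 0 then l else 0)"
    using assms(1) sum_atLeastAtMost_eq_triangle[of s] sum_diff_eq_triangle[of "s - b" s]
    by (simp add: sum.distrib)
  also have "(\<Sum>j = 1..s. if j \<le> a then j else 0) = triangle a"
  proof -
    have "{j \<in> {1..s}. j \<le> a} = {1..a}" using ab by auto
    then show ?thesis
      using sum_atLeastAtMost_eq_triangle[of a] by (simp flip: sum.inter_filter)
  qed
  also have "s - (s - b) = b" using ab by simp
  finally have "sum_mset lam = triangle s + q"
    using assms(3) a0 by (cases "a = 0") (auto simp: l_def)
  moreover have "0 \<notin># lam"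
    unfolding lam by (rule zero_notin_of_compressed) (use pos in auto)
  ultimately show "lam \<in> partitions (triangle s + q)"
    by (simp add: partitions_def)
qed

lemma deg_canonical:
  assumes "1 \<le> s" "q \<le> s" "triangle a + triangle b \<le> q" "a = 0 \<Longrightarrow> triangle b = q"
  shows "deg (triangle s + q) (canonical s q a b) + s = s * s + a + b"
  using deg_eq[OF canonical(1)[OF assms]] canonical(2-4)[OF assms] by simp

section \<open>Maximisers and their types\<close>

text \<open>A larger support needs size at least \<open>triangle (Suc s)\<close>, which exceeds
  \<open>triangle s + q\<close>. A smaller one loses at least \<open>2 * r\<close> in the quadratic
  term of the degree, and both counts together regain at most \<open>2 * r\<close>; only the
  equality case needs the sharper size bound.\<close>

lemma support_size_max_partition:
  assumes "1 \<le> s" "q \<le> s" "lam \<in> max_partitions (triangle s + q)"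
  shows "support_size lam = s"
proof (rule ccontr)
  let ?n = "triangle s + q" and ?r = "support_size lam"
  assume neq: "?r \<noteq> s"
  have lam: "lam \<in> partitions ?n" "deg ?n lam = max_deg ?n"
    using assms(3) by (auto simp: max_partitions_def)
  note size = partition_size_ge[OF lam(1)]
  have A: "A_num lam \<le> ?r" and B: "B_num lam \<le> ?r"
    using lam(1) card_repeated_le[of lam] card_gap_set_le[of "set_mset lam"]
    by (auto simp: partitions_def A_num_eq B_num_eq support_size_def)
  have "?r < s"
  proof (rule ccontr)
    assume "\<not> ?r < s"
    then have "triangle (Suc s) \<le> triangle ?r" using neq by (intro triangle_mono) simp
    then show False using size assms(2) by simp
  qed
  then obtain d where d: "s = Suc (?r + d)" using less_imp_Suc_add by blast
  \<comment> \<open>For \<open>q = 0\<close> only type \<open>(0, 0)\<close> fits; for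
    \<open>q > 0\<close> type \<open>(1, 0)\<close> does, and its extra unit of degree excludes
    equality.\<close>
  define e :: nat where "e = (if q = 0 then 0 else 1)"
  have e: "triangle e + triangle 0 \<le> q" "e = 0 \<Longrightarrow> triangle 0 = q"
    by (auto simp: e_def split: if_splits)
  have "deg ?n (canonical s q e 0) \<le> deg ?n lam"
    unfolding lam(2) by (rule deg_le_max_deg[OF canonical(1)[OF assms(1,2) e]])
  then have "s * s + e + ?r \<le> ?r * ?r + A_num lam + B_num lam + s"
    using deg_canonical[OF assms(1,2) e] deg_eq[OF lam(1)] by simp
  moreover have "s * s + ?r = ?r * ?r + ?r + ?r + s + d * (2 * ?r + d + 1)"
    by (subst (1 2 3) d) (simp add: algebra_simps)
  ultimately have le: "?r + ?r + d * (2 * ?r + d + 1) + e \<le> A_num lam + B_num lam" by simp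
  have "d = 0" "e = 0" and AB: "A_num lam = ?r" "B_num lam = ?r"
    using le A B by (auto simp: add_eq_0_iff)
  have "q = 0" using \<open>e = 0\<close> by (simp add: e_def split: if_splits)
  have "4 * triangle ?r \<le> triangle ?r + Suc ?r"
    using partition_size_ge_full[OF lam(1) AB] d \<open>d = 0\<close> \<open>q = 0\<close> by simp
  \<comment> \<open>From \<open>3 * triangle r \<le> r + 1\<close> and
    \<open>r \<le> triangle r\<close> follows \<open>2 * r \<le> 1\<close>.\<close>
  then have "?r = 0" using le_triangle[of ?r] by linarith
  then have "lam = {#}" by (simp add: support_size_def)
  then show False
    using lam(1) le_triangle[of s] assms(1) by (auto simp: partitions_def)
qed

theorem proposition6p3:
  fixes s q n :: nat
  assumes "s \<ge> 1" and "q \<le> s" and "n = triangle s + q"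
  shows "(\<forall>(a, b) \<in> max_types n. canonical s q a b \<in> fibre n a b) \<and>
         (\<forall>(a, b) \<in> max_types n. fibre n a b \<noteq> {})"
proof -
  have "canonical s q a b \<in> fibre n a b" if ab: "(a, b) \<in> max_types n" for a b
  proof -
    obtain lam where lam: "lam \<in> max_partitions n" and AB: "A_num lam = a" "B_num lam = b"
      using ab by (auto simp: max_types_def)
    have part: "lam \<in> partitions n" and max: "deg n lam = max_deg n"
      using lam by (auto simp: max_partitions_def)
    have supp: "support_size lam = s"
      using support_size_max_partition lam assms by blast
    have le: "triangle a + triangle b \<le> q"
      using partition_size_ge[OF part] supp AB assms(3) by simp
    have deg: "deg n lam + s = s * s + a + b"
      using deg_eq[OF part] supp AB by simp
    \<comment> \<open>With \<open>a = 0\<close> and positive surplus, type \<open>(1, b)\<close>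
      would also fit, since \<open>triangle 1 = 1\<close>, and its degree would be larger by
      one.\<close>
    have a0: "triangle b = q" if "a = 0"
    proof (rule ccontr)
      assume "triangle b \<noteq> q"
      then have le1: "triangle 1 + triangle b \<le> q" using le by simp
      have "deg n (canonical s q 1 b) \<le> deg n lam"
        unfolding max using canonical(1)[OF assms(1,2) le1] assms(3)
        by (intro deg_le_max_deg) simp
      then show False
        using deg_canonical[OF assms(1,2) le1] deg assms(3) that by simp
    qed
    note can = canonical[OF assms(1,2) le a0]
    have "deg n (canonical s q a b) = max_deg n"
      using deg_canonical[OF assms(1,2) le a0] deg max assms(3) by simp
    then show ?thesis
      using can assms(3) by (simp add: fibre_def max_partitions_def)
  qed
  then show ?thesis by blast
qed

end
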